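(* For every group $G$ acting acylindrically on a hyperbolic space, the following hold. (a) Every elliptic subgroup of $G$ is contained in a maximal elliptic subgroup of $G$. (b) For every infinite maximal elliptic subgroup $H\le G$, we have $H=Comm_G(H)$.
   Context: All actions on metric spaces are by isometries. A metric space is hyperbolic if it is geodesic and for some $\delta\ge0$ every side of every geodesic triangle lies in the union of the $\delta$-neighborhoods of the other two sides; it is not assumed proper. An action of $G$ on $(S,d)$ is acylindrical if for every $\varepsilon>0$ there exist $R,N>0$ such that for all $x,y\in S$ with $d(x,y)\ge R$ there are at most $N$ elements $g\in G$ with $d(x,gx)\le\varepsilon$ and $d(y,gy)\le\varepsilon$. A subgroup of $G$ is elliptic if its orbits in the space are bounded; a maximal elliptic subgroup is an elliptic subgroup that is maximal with respect to inclusion among elliptic subgroups of $G$. For $H\le G$, the commensurator is $$Comm_G(H)=\{g\in G\mid [H:H\cap H^g]<\infty\ \text{and}\ [H^g:H\cap H^g]<\infty\},$$ where $H^g=g^{-1}Hg$. *)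

theory Defs
  imports "HOL-Analysis.Abstract_Metric_Spaces" "HOL-Algebra.Group_Action"
begin

context Metric_space
begin

definition geodesic_segment :: "'a \<Rightarrow> 'a \<Rightarrow> 'a set \<Rightarrow> bool" where
  "geodesic_segment x y A \<longleftrightarrow>
     x \<in> M \<and> y \<in> M \<and>
     (\<exists>c::real \<Rightarrow> 'a.
        c \<in> {0..d x y} \<rightarrow> M \<and> c 0 = x \<and> c (d x y) = y \<and>
        (\<forall>s\<in>{0..d x y}. \<forall>t\<in>{0..d x y}. d (c s) (c t) = \<bar>s - t\<bar>) \<and>
        A = c ` {0..d x y})"

text \<open>The neighbourhoods are closed, so that \<open>\<delta> = 0\<close> is meaningful.\<close>

definition neighbourhood :: "real \<Rightarrow> 'a set \<Rightarrow> 'a set" where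
  "neighbourhood \<delta> A = {p \<in> M. \<exists>q\<in>A. d p q \<le> \<delta>}"

end

locale hyperbolic_space = Metric_space M d for M :: "'s set" and d +
  assumes geodesic: "\<lbrakk>x \<in> M; y \<in> M\<rbrakk> \<Longrightarrow> \<exists>A. geodesic_segment x y A"
    and thin_triangles:
      "\<exists>\<delta>\<ge>0. \<forall>x y z A B C.
         geodesic_segment x y A \<and> geodesic_segment y z B \<and> geodesic_segment z x C \<longrightarrow>
           A \<subseteq> neighbourhood \<delta> B \<union> neighbourhood \<delta> C \<and>
           B \<subseteq> neighbourhood \<delta> A \<union> neighbourhood \<delta> C \<and>
           C \<subseteq> neighbourhood \<delta> A \<union> neighbourhood \<delta> B"

locale isometric_action = Metric_space M d + group_action G M \<phi>
  for G :: "('g, 'm) monoid_scheme" (structure) and M :: "'s set" and d and \<phi> +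
  assumes isometric:
    "\<lbrakk>g \<in> carrier G; x \<in> M; y \<in> M\<rbrakk> \<Longrightarrow> d (\<phi> g x) (\<phi> g y) = d x y"

locale acylindrical_action = isometric_action G M d \<phi>
  for G :: "('g, 'm) monoid_scheme" (structure) and M :: "'s set" and d and \<phi> +
  assumes acylindrical:
    "\<forall>\<epsilon>>0. \<exists>R>0. \<exists>N::nat. N > 0 \<and>
       (\<forall>x\<in>M. \<forall>y\<in>M. d x y \<ge> R \<longrightarrow>
          finite {g \<in> carrier G. d x (\<phi> g x) \<le> \<epsilon> \<and> d y (\<phi> g y) \<le> \<epsilon>} \<and>
          card {g \<in> carrier G. d x (\<phi> g x) \<le> \<epsilon> \<and> d y (\<phi> g y) \<le> \<epsilon>} \<le> N)"

definition elliptic_subgroup ::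
  "('g, 'm) monoid_scheme \<Rightarrow> 's set \<Rightarrow> ('s \<Rightarrow> 's \<Rightarrow> real) \<Rightarrow> ('g \<Rightarrow> 's \<Rightarrow> 's) \<Rightarrow> 'g set \<Rightarrow> bool"
  where
  "elliptic_subgroup G M d \<phi> H \<longleftrightarrow>
     subgroup H G \<and> (\<forall>x\<in>M. Metric_space.mbounded M d (orbit (G\<lparr>carrier := H\<rparr>) \<phi> x))"

definition maximal_elliptic_subgroup ::
  "('g, 'm) monoid_scheme \<Rightarrow> 's set \<Rightarrow> ('s \<Rightarrow> 's \<Rightarrow> real) \<Rightarrow> ('g \<Rightarrow> 's \<Rightarrow> 's) \<Rightarrow> 'g set \<Rightarrow> bool"
  where
  "maximal_elliptic_subgroup G M d \<phi> H \<longleftrightarrow>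
     elliptic_subgroup G M d \<phi> H \<and>
     (\<forall>K. elliptic_subgroup G M d \<phi> K \<and> H \<subseteq> K \<longrightarrow> K = H)"

definition finite_index :: "('g, 'm) monoid_scheme \<Rightarrow> 'g set \<Rightarrow> 'g set \<Rightarrow> bool" where
  "finite_index G H K \<longleftrightarrow> finite (rcosets\<^bsub>G\<lparr>carrier := H\<rparr>\<^esub> K)"

definition conjugate :: "('g, 'm) monoid_scheme \<Rightarrow> 'g set \<Rightarrow> 'g \<Rightarrow> 'g set" where
  "conjugate G H g = (inv\<^bsub>G\<^esub> g <#\<^bsub>G\<^esub> H) #>\<^bsub>G\<^esub> g"

definition commensurator :: "('g, 'm) monoid_scheme \<Rightarrow> 'g set \<Rightarrow> 'g set" where
  "commensurator G H =
     {g \<in> carrier G. finite_index G H (H \<inter> conjugate G H g) \<and>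
                     finite_index G (conjugate G H g) (H \<inter> conjugate G H g)}"

end

theory Submission
  imports Defs
begin

text \<open>
  The quasi-centres of a bounded orbit show that every elliptic subgroup moves some point by at
  most a constant depending only on \<open>\<delta>\<close>. By acylindricity the points that an infinite (or merely
  large) subgroup moves by at most that constant form a set of bounded diameter. Along a chain of
  elliptic subgroups, either the orders are bounded and the chain stabilises, or the quasi-centres
  of all large members stay close to each other; in both cases the union is elliptic, and Zorn's
  lemma applies. Likewise, if \<open>H\<close> is infinite and moves \<open>x\<close> by at most \<open>\<epsilon>\<close>, and \<open>g\<close> commensurates
  \<open>H\<close>, then the infinite group \<open>H \<inter> H\<^sup>g\<close> moves both \<open>x\<close> and \<open>g\<^sup>-\<^sup>1x\<close> by at most \<open>\<epsilon>\<close>, so the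
  commensurator has a bounded orbit.
\<close>

section \<open>Quasi-centres of bounded sets\<close>

context Metric_space
begin

lemma geodesic_segmentE:
  assumes "geodesic_segment x y A"
  obtains c where "c \<in> {0..d x y} \<rightarrow> M" "c 0 = x" "c (d x y) = y"
    "\<And>s t. s \<in> {0..d x y} \<Longrightarrow> t \<in> {0..d x y} \<Longrightarrow> d (c s) (c t) = \<bar>s - t\<bar>"
    "A = c ` {0..d x y}"
  using assms unfolding geodesic_segment_def by (elim conjE exE) (rule that; simp)

lemma geodesic_segment_dist_add:
  assumes "geodesic_segment x y A" "p \<in> A"
  shows "p \<in> M" "d x p + d p y = d x y"
proof -
  obtain c where c: "c \<in> {0..d x y} \<rightarrow> M" "c 0 = x" "c (d x y) = y"
    "\<And>s t. s \<in> {0..d x y} \<Longrightarrow> t \<in> {0..d x y} \<Longrightarrow> d (c s) (c t) = \<bar>s - t\<bar>"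
    "A = c ` {0..d x y}"
    by (rule geodesic_segmentE[OF assms(1)]) (rule that; simp)
  obtain t where t: "t \<in> {0..d x y}" "p = c t" using assms(2) c(5) by blast
  show "p \<in> M" using t c(1) by auto
  show "d x p + d p y = d x y" using c(4)[of 0 t] c(4)[of t "d x y"] c(2,3) t by auto
qed

lemma geodesic_segment_midpoint:
  assumes "geodesic_segment x y A"
  obtains m where "m \<in> A" "d x m = d x y / 2" "d m y = d x y / 2"
proof -
  obtain c where c: "c \<in> {0..d x y} \<rightarrow> M" "c 0 = x" "c (d x y) = y"
    "\<And>s t. s \<in> {0..d x y} \<Longrightarrow> t \<in> {0..d x y} \<Longrightarrow> d (c s) (c t) = \<bar>s - t\<bar>"
    "A = c ` {0..d x y}"
    by (rule geodesic_segmentE[OF assms(1)]) (rule that; simp)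
  let ?t = "d x y / 2"
  have t: "?t \<in> {0..d x y}" "0 \<in> {0..d x y}" "d x y \<in> {0..d x y}" by simp_all
  have "d x (c ?t) = ?t" using c(4)[OF t(2,1)] c(2) by simp
  moreover have "d (c ?t) y = ?t"
    using c(4)[OF t(1,3)] c(3) abs_of_nonpos[of "?t - d x y"] nonneg[of x y] by simp
  moreover have "c ?t \<in> A" using t(1) c(5) by blast
  ultimately show ?thesis by (intro that)
qed

text \<open>For \<open>m\<close> on the segment itself the bound holds with equality and no error
  term. Replacing \<open>m\<close> by a point \<open>p\<close> of the segment at distance at most
  \<open>\<delta>\<close> costs one \<open>\<delta>\<close> in \<open>d m y\<close> and another in
  \<open>d x m\<close>.\<close>

lemma geodesic_segment_dist_le_of_near:
  assumes A: "geodesic_segment x y A" and m: "m \<in> M" "m \<in> neighbourhood \<delta> A"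
  shows "d m y \<le> d x y - d x m + 2 * \<delta>"
proof -
  obtain p where p: "p \<in> A" "d m p \<le> \<delta>" using m(2) unfolding neighbourhood_def by auto
  have pM: "p \<in> M" and "d x p + d p y = d x y" using geodesic_segment_dist_add[OF A p(1)] by auto
  moreover have "x \<in> M" "y \<in> M" using A unfolding geodesic_segment_def by simp_all
  then have "d m y \<le> d m p + d p y" "d x m \<le> d x p + d p m"
    using triangle m(1) pM by simp_all
  ultimately show ?thesis using commute[of m p] p(2) by linarith
qed

text \<open>Segments carry a direction, and a triangle in \<open>thin_triangles\<close> is traversed
  cyclically. Reversal allows the estimate above to start from either endpoint of a side.\<close>

lemma geodesic_segment_commute:
  assumes "geodesic_segment x y A"
  shows "geodesic_segment y x A"
proof -
  obtain c where c: "c \<in> {0..d x y} \<rightarrow> M" "c 0 = x" "c (d x y) = y"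
    "\<And>s t. s \<in> {0..d x y} \<Longrightarrow> t \<in> {0..d x y} \<Longrightarrow> d (c s) (c t) = \<bar>s - t\<bar>"
    "A = c ` {0..d x y}"
    by (rule geodesic_segmentE[OF assms(1)]) (rule that; simp)
  have xy: "x \<in> M" "y \<in> M" using assms unfolding geodesic_segment_def by auto
  let ?c = "\<lambda>t. c (d x y - t)"
  have "A = ?c ` {0..d x y}"
  proof
    show "A \<subseteq> ?c ` {0..d x y}"
    proof
      fix p assume "p \<in> A"
      then obtain t where "t \<in> {0..d x y}" "p = c t" using c(5) by blast
      then show "p \<in> ?c ` {0..d x y}" by (intro image_eqI[of _ _ "d x y - t"]) auto
    qed
    show "?c ` {0..d x y} \<subseteq> A" using c(5) by auto
  qed
  moreover have "?c \<in> {0..d x y} \<rightarrow> M" using c(1) by auto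
  moreover have "\<forall>s\<in>{0..d x y}. \<forall>t\<in>{0..d x y}. d (?c s) (?c t) = \<bar>s - t\<bar>"
    using c(4) by auto
  ultimately have "?c \<in> {0..d y x} \<rightarrow> M \<and> ?c 0 = y \<and> ?c (d y x) = x \<and>
      (\<forall>s\<in>{0..d y x}. \<forall>t\<in>{0..d y x}. d (?c s) (?c t) = \<bar>s - t\<bar>) \<and> A = ?c ` {0..d y x}"
    using c(2,3) by (simp add: commute[of y x])
  then show ?thesis using xy unfolding geodesic_segment_def by blast
qed

end

context hyperbolic_space
begin

text \<open>If \<open>x\<close> and \<open>x'\<close> are both within \<open>r\<close> of all of
  \<open>Y\<close>, thinness puts their midpoint within \<open>r - d x x' / 2 + 2 * \<delta>\<close>
  of all of \<open>Y\<close>. For \<open>r\<close> almost minimal this cannot be much smaller than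
  \<open>r\<close>, which bounds \<open>d x x'\<close>. One radius \<open>r\<close> serves for all
  near-centres, so an isometry preserving \<open>Y\<close> permutes them.\<close>

lemma near_centres_close:
  obtains C where "C > 0"
    "\<And>Y. Y \<subseteq> M \<Longrightarrow> Y \<noteq> {} \<Longrightarrow> mbounded Y \<Longrightarrow>
       \<exists>r. (\<exists>x\<in>M. \<forall>y\<in>Y. d x y \<le> r) \<and>
           (\<forall>x\<in>M. \<forall>x'\<in>M. (\<forall>y\<in>Y. d x y \<le> r) \<longrightarrow> (\<forall>y\<in>Y. d x' y \<le> r) \<longrightarrow> d x x' \<le> C)"
proof -
  obtain \<delta> where \<delta>: "\<delta> \<ge> 0" and *: "\<forall>x y z A B C.
      geodesic_segment x y A \<and> geodesic_segment y z B \<and> geodesic_segment z x C \<longrightarrow>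
        A \<subseteq> neighbourhood \<delta> B \<union> neighbourhood \<delta> C \<and>
        B \<subseteq> neighbourhood \<delta> A \<union> neighbourhood \<delta> C \<and>
        C \<subseteq> neighbourhood \<delta> A \<union> neighbourhood \<delta> B"
    using thin_triangles by (elim exE conjE) (rule that; assumption)
  have thin: "A \<subseteq> neighbourhood \<delta> B \<union> neighbourhood \<delta> C"
    if "geodesic_segment x y A" "geodesic_segment y z B" "geodesic_segment z x C" for x y z A B C
    using * that by simp
  have "\<exists>r. (\<exists>x\<in>M. \<forall>y\<in>Y. d x y \<le> r) \<and>
           (\<forall>x\<in>M. \<forall>x'\<in>M. (\<forall>y\<in>Y. d x y \<le> r) \<longrightarrow> (\<forall>y\<in>Y. d x' y \<le> r) \<longrightarrow> d x x' \<le> 4 * \<delta> + 4)"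
    if Y: "Y \<subseteq> M" "Y \<noteq> {}" "mbounded Y" for Y
  proof -
    define S where "S = {r. \<exists>x\<in>M. \<forall>y\<in>Y. d x y \<le> r}"
    obtain c B where "Y \<subseteq> mcball c B" using Y(3) unfolding mbounded_def by blast
    then have "B \<in> S" using Y(2) unfolding S_def by (force simp: mcball_def)
    moreover have "0 \<le> r" if r: "r \<in> S" for r
    proof -
      obtain x y where "d x y \<le> r" using r Y(2) unfolding S_def by blast
      then show ?thesis using nonneg[of x y] by linarith
    qed
    ultimately have S: "S \<noteq> {}" "bdd_below S" by (auto intro: bdd_belowI[of S 0])
    \<comment> \<open>Without properness the infimal radius need not be attained, so a radius within
      1 of it is taken.\<close>
    obtain r where r: "r \<in> S" "r < Inf S + 1" using cInf_lessD[OF S(1), of "Inf S + 1"] by auto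
    have "d x x' \<le> 4 * \<delta> + 4"
      if x: "x \<in> M" "\<And>y. y \<in> Y \<Longrightarrow> d x y \<le> r" and x': "x' \<in> M" "\<And>y. y \<in> Y \<Longrightarrow> d x' y \<le> r" for x x'
    proof -
      obtain A where A: "geodesic_segment x x' A" using geodesic x(1) x'(1) by blast
      obtain m where m: "m \<in> A" "d x m = d x x' / 2" "d m x' = d x x' / 2"
        using geodesic_segment_midpoint[OF A] by blast
      have mM: "m \<in> M" using geodesic_segment_dist_add(1)[OF A m(1)] .
      \<comment> \<open>Whichever of the other two sides \<open>m\<close> is near, it lies at
        distance \<open>d x x' / 2\<close> from the end of that side in {\<open>x\<close>,
        \<open>x'\<close>}, and this end is within \<open>r\<close> of \<open>y\<close>.\<close>
      have "d m y \<le> r - d x x' / 2 + 2 * \<delta>" if y: "y \<in> Y" for y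
      proof -
        have yM: "y \<in> M" using y Y(1) by blast
        obtain B C where B: "geodesic_segment x' y B" and C: "geodesic_segment y x C"
          using geodesic x(1) x'(1) yM by blast
        consider "m \<in> neighbourhood \<delta> B" | "m \<in> neighbourhood \<delta> C"
          using thin[OF A B C] m(1) by blast
        then show ?thesis
        proof cases
          case 1
          then show ?thesis
            using geodesic_segment_dist_le_of_near[OF B mM 1] x'(2)[OF y] m(3) commute[of m x']
            by linarith
        next
          case 2
          then show ?thesis
            using geodesic_segment_dist_le_of_near[OF geodesic_segment_commute[OF C] mM 2]
              x(2)[OF y] m(2) by linarith
        qed
      qed
      then have "r - d x x' / 2 + 2 * \<delta> \<in> S" using mM unfolding S_def by blast
      then have "Inf S \<le> r - d x x' / 2 + 2 * \<delta>" using S(2) by (rule cInf_lower)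
      \<comment> \<open>Together with \<open>r < Inf S + 1\<close> this even gives
        \<open>d x x' < 4 * \<delta> + 2\<close>.\<close>
      then show ?thesis using r(2) by linarith
    qed
    then show ?thesis
      using r(1) unfolding S_def by (intro exI[of _ r] conjI ballI impI) simp_all
  qed
  with \<delta> show ?thesis by (intro that[of "4 * \<delta> + 4"]) auto
qed

end

section \<open>Elliptic subgroups\<close>

context isometric_action
begin

sublocale group G
  using group_hom by (rule group_hom.axioms(1))

lemma action_closed [simp]: "g \<in> carrier G \<Longrightarrow> x \<in> M \<Longrightarrow> \<phi> g x \<in> M"
  using element_image by blast

text \<open>Bounded displacement at one point suffices: by the triangle inequality and isometry,
  passing to a second point adds at most twice the distance between the two.\<close>

lemma elliptic_subgroup_iff:
  assumes "x \<in> M"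
  shows "elliptic_subgroup G M d \<phi> H \<longleftrightarrow> subgroup H G \<and> (\<exists>B. \<forall>h\<in>H. d x (\<phi> h x) \<le> B)"
proof (cases "subgroup H G")
  case True
  have "mbounded (orbit (G\<lparr>carrier := H\<rparr>) \<phi> x)" (is "mbounded ?O")
    if "x \<in> M" and B: "\<forall>h\<in>H. d y (\<phi> h y) \<le> B" "y \<in> M" for x y B
  proof -
    have "?O \<subseteq> mcball x (2 * d x y + B)"
    proof
      fix z assume "z \<in> ?O"
      then obtain h where h: "h \<in> H" "z = \<phi> h x" unfolding orbit_def by auto
      have hG: "h \<in> carrier G" using subgroup.mem_carrier[OF True h(1)] .
      have zM: "z \<in> M" "\<phi> h y \<in> M" using h(2) hG that by auto
      have "d z (\<phi> h y) = d x y" using isometric[OF hG] that h(2) by simp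
      moreover have "d y (\<phi> h y) \<le> B" using B h(1) by simp
      ultimately have "d x z \<le> 2 * d x y + B"
        using triangle[OF \<open>x \<in> M\<close> \<open>y \<in> M\<close> zM(1)] triangle[OF \<open>y \<in> M\<close> zM(2,1)]
          commute[of z "\<phi> h y"] by linarith
      then show "z \<in> mcball x (2 * d x y + B)" using \<open>x \<in> M\<close> zM(1) by (simp add: mcball_def)
    qed
    then show ?thesis unfolding mbounded_def by blast
  qed
  moreover have "\<exists>B. \<forall>h\<in>H. d x (\<phi> h x) \<le> B" if O: "mbounded (orbit (G\<lparr>carrier := H\<rparr>) \<phi> x)"
  proof -
    obtain c B where cB: "orbit (G\<lparr>carrier := H\<rparr>) \<phi> x \<subseteq> mcball c B"
      using O unfolding mbounded_def by blast
    have "d x (\<phi> h x) \<le> d x c + B" if h: "h \<in> H" for h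
    proof -
      have "\<phi> h x \<in> orbit (G\<lparr>carrier := H\<rparr>) \<phi> x" using h unfolding orbit_def by auto
      then have "\<phi> h x \<in> mcball c B" using cB by blast
      then have c: "c \<in> M" "\<phi> h x \<in> M" "d c (\<phi> h x) \<le> B" by (simp_all add: mcball_def)
      then show ?thesis using triangle[OF assms c(1,2)] by linarith
    qed
    then show ?thesis by blast
  qed
  ultimately show ?thesis using True assms unfolding elliptic_subgroup_def by blast
qed (simp add: elliptic_subgroup_def)

text \<open>The second premise is conditional on a point of \<open>M\<close>, so that the rule also
  covers the empty space, where every subgroup is elliptic.\<close>

lemma elliptic_subgroupI:
  assumes "subgroup H G" "\<And>x. x \<in> M \<Longrightarrow> \<exists>y\<in>M. \<exists>B. \<forall>h\<in>H. d y (\<phi> h y) \<le> B"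
  shows "elliptic_subgroup G M d \<phi> H"
proof (cases "M = {}")
  case True
  then show ?thesis using assms(1) unfolding elliptic_subgroup_def by simp
next
  case False
  then show ?thesis using assms elliptic_subgroup_iff by blast
qed

text \<open>\<open>H\<close> permutes each of its orbits, so it carries a near-centre of an orbit to
  near-centres of the same radius, and these are uniformly close. The point is that \<open>C\<close>
  does not depend on \<open>H\<close>.\<close>

lemma elliptic_subgroup_quasi_centre:
  assumes "hyperbolic_space M d" "M \<noteq> {}"
  obtains C where "C > 0"
    "\<And>H. elliptic_subgroup G M d \<phi> H \<Longrightarrow> \<exists>x\<in>M. \<forall>h\<in>H. d x (\<phi> h x) \<le> C"
proof -
  interpret hyperbolic_space M d by fact
  obtain C where C: "C > 0"
    "\<And>Y. Y \<subseteq> M \<Longrightarrow> Y \<noteq> {} \<Longrightarrow> mbounded Y \<Longrightarrow>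
       \<exists>r. (\<exists>x\<in>M. \<forall>y\<in>Y. d x y \<le> r) \<and>
           (\<forall>x\<in>M. \<forall>x'\<in>M. (\<forall>y\<in>Y. d x y \<le> r) \<longrightarrow> (\<forall>y\<in>Y. d x' y \<le> r) \<longrightarrow> d x x' \<le> C)"
    by (rule near_centres_close) (rule that; blast)
  have "\<exists>x\<in>M. \<forall>h\<in>H. d x (\<phi> h x) \<le> C" if H: "elliptic_subgroup G M d \<phi> H" for H
  proof -
    have sub: "subgroup H G" using H unfolding elliptic_subgroup_def by simp
    have HG: "h \<in> carrier G" if "h \<in> H" for h using subgroup.mem_carrier[OF sub that] .
    obtain s where s: "s \<in> M" using assms(2) by blast
    define Y where "Y = orbit (G\<lparr>carrier := H\<rparr>) \<phi> s"
    have Y_eq: "Y = {\<phi> h s |h. h \<in> H}" unfolding Y_def orbit_def by simp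
    have "Y \<subseteq> M" using Y_eq action_closed[OF HG s] by auto
    moreover have "Y \<noteq> {}" using Y_eq subgroup.one_closed[OF sub] by blast
    moreover have "mbounded Y" using H s unfolding elliptic_subgroup_def Y_def by blast
    ultimately obtain r x where x: "x \<in> M" "\<forall>y\<in>Y. d x y \<le> r" and
      close: "\<forall>x\<in>M. \<forall>x'\<in>M. (\<forall>y\<in>Y. d x y \<le> r) \<longrightarrow> (\<forall>y\<in>Y. d x' y \<le> r) \<longrightarrow> d x x' \<le> C"
      using C(2)[of Y] by blast
    have "d x (\<phi> h x) \<le> C" if h: "h \<in> H" for h
    proof -
      have "d (\<phi> h x) y \<le> r" if y: "y \<in> Y" for y
      proof -
        obtain k where k: "k \<in> H" "y = \<phi> k s" using y Y_eq by blast
        define k' where "k' = inv h \<otimes> k"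
        have k': "k' \<in> H" "h \<otimes> k' = k"
          unfolding k'_def using sub h k(1) HG
          by (auto simp: subgroup.m_closed subgroup.m_inv_closed m_assoc[symmetric])
        then have "y = \<phi> h (\<phi> k' s)" using composition_rule[OF s HG[OF h] HG[OF k'(1)]] k(2) by simp
        then have "d (\<phi> h x) y = d x (\<phi> k' s)"
          using isometric[OF HG[OF h] x(1)] action_closed[OF HG[OF k'(1)] s] by simp
        then show ?thesis using x(2) Y_eq k'(1) by auto
      qed
      moreover have "\<phi> h x \<in> M" using action_closed[OF HG[OF h] x(1)] by simp
      ultimately show ?thesis using close x by blast
    qed
    then show ?thesis using x(1) by blast
  qed
  then show ?thesis using that C(1) by blast
qed

end

section \<open>Unions of chains\<close>

lemma (in group) subgroup_Union_chain:
  assumes "\<C> \<noteq> {}" "\<And>H. H \<in> \<C> \<Longrightarrow> subgroup H G" "\<And>H K. H \<in> \<C> \<Longrightarrow> K \<in> \<C> \<Longrightarrow> H \<subseteq> K \<or> K \<subseteq> H"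
  shows "subgroup (\<Union>\<C>) G"
proof (rule subgroupI)
  show "\<Union>\<C> \<subseteq> carrier G" using subgroup.subset[OF assms(2)] by blast
  show "\<Union>\<C> \<noteq> {}" using assms(1) subgroup.one_closed[OF assms(2)] by blast
  show "inv a \<in> \<Union>\<C>" if "a \<in> \<Union>\<C>" for a
    using that subgroup.m_inv_closed[OF assms(2)] by blast
  show "a \<otimes> b \<in> \<Union>\<C>" if ab: "a \<in> \<Union>\<C>" "b \<in> \<Union>\<C>" for a b
  proof -
    obtain H K where "H \<in> \<C>" "K \<in> \<C>" "a \<in> H" "b \<in> K" using ab by blast
    then obtain L where L: "L \<in> \<C>" "a \<in> L" "b \<in> L" using assms(3)[of H K] by blast
    then show ?thesis using subgroup.m_closed[OF assms(2)[OF L(1)]] by blast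
  qed
qed

text \<open>A member of greatest cardinality is comparable with every other member and hence
  contains it.\<close>

lemma Union_chain_eq_member_of_card_le:
  fixes N :: nat
  assumes "\<C> \<noteq> {}" "\<And>H. H \<in> \<C> \<Longrightarrow> finite H \<and> card H \<le> N"
    and "\<And>H K. H \<in> \<C> \<Longrightarrow> K \<in> \<C> \<Longrightarrow> H \<subseteq> K \<or> K \<subseteq> H"
  shows "\<Union>\<C> \<in> \<C>"
proof -
  obtain H where "H \<in> \<C>" using assms(1) by blast
  then have "\<exists>K. K \<in> \<C> \<and> (\<forall>H. H \<in> \<C> \<longrightarrow> card H \<le> card K)"
    using assms(2) by (intro ex_has_greatest_nat[of _ H card "Suc N"]) (simp_all add: less_Suc_eq_le)
  then obtain K where K: "K \<in> \<C>" "\<And>H. H \<in> \<C> \<Longrightarrow> card H \<le> card K" by blast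
  have "H \<subseteq> K" if "H \<in> \<C>" for H
    using assms(3)[OF that K(1)] card_seteq[of H K] assms(2)[OF that] K(2)[OF that] by blast
  then have "\<Union>\<C> = K" using K(1) by blast
  then show ?thesis using K(1) by simp
qed

section \<open>Acylindricity and the existence of maximal elliptic subgroups\<close>

context acylindrical_action
begin

text \<open>The contrapositive of acylindricity, with \<open>R\<close> and \<open>N\<close>
  depending only on \<open>\<epsilon>\<close>. Infinite sets and finite sets with more than
  \<open>N\<close> elements are treated together; since \<open>card\<close> is 0 on infinite sets,
  \<open>card H \<le> N\<close> alone would not express smallness.\<close>

lemma large_subgroup_fixes_close_points:
  assumes "\<epsilon> > 0"
  obtains R and N :: nat where
    "\<And>H x y. H \<subseteq> carrier G \<Longrightarrow> \<not> (finite H \<and> card H \<le> N) \<Longrightarrow> x \<in> M \<Longrightarrow> y \<in> M \<Longrightarrow>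
       (\<And>h. h \<in> H \<Longrightarrow> d x (\<phi> h x) \<le> \<epsilon> \<and> d y (\<phi> h y) \<le> \<epsilon>) \<Longrightarrow> d x y \<le> R"
proof -
  define F where "F x y = {g \<in> carrier G. d x (\<phi> g x) \<le> \<epsilon> \<and> d y (\<phi> g y) \<le> \<epsilon>}" for x y
  have "\<exists>R>0. \<exists>N::nat. N > 0 \<and>
      (\<forall>x\<in>M. \<forall>y\<in>M. d x y \<ge> R \<longrightarrow> finite (F x y) \<and> card (F x y) \<le> N)"
    using acylindrical assms unfolding F_def by simp
  then obtain R and N :: nat where RN:
    "\<And>x y. x \<in> M \<Longrightarrow> y \<in> M \<Longrightarrow> d x y \<ge> R \<Longrightarrow> finite (F x y) \<and> card (F x y) \<le> N"
    by blast
  show ?thesis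
  proof (rule that[of N R])
    fix H x y
    assume H: "H \<subseteq> carrier G" "\<not> (finite H \<and> card H \<le> N)" and xy: "x \<in> M" "y \<in> M"
      and small: "\<And>h. h \<in> H \<Longrightarrow> d x (\<phi> h x) \<le> \<epsilon> \<and> d y (\<phi> h y) \<le> \<epsilon>"
    have "H \<subseteq> F x y" using H(1) small unfolding F_def by blast
    then have "finite H \<and> card H \<le> N" if "finite (F x y) \<and> card (F x y) \<le> N"
      using that finite_subset[of H "F x y"] card_mono[of "F x y" H] by simp
    then show "d x y \<le> R" using RN[OF xy] H(2) by (cases "R \<le> d x y") simp_all
  qed
qed

text \<open>The bounds for the single members could grow along the chain. The uniform
  \<open>\<epsilon>\<close> prevents this: a large member \<open>K\<close> ties the quasi-centres of
  all members above it to its own.\<close>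

lemma elliptic_subgroup_Union_chain:
  assumes hyp: "hyperbolic_space M d" and ne: "\<C> \<noteq> {}"
    and ell: "\<And>H. H \<in> \<C> \<Longrightarrow> elliptic_subgroup G M d \<phi> H"
    and chain: "\<And>H K. H \<in> \<C> \<Longrightarrow> K \<in> \<C> \<Longrightarrow> H \<subseteq> K \<or> K \<subseteq> H"
  shows "elliptic_subgroup G M d \<phi> (\<Union>\<C>)"
proof (rule elliptic_subgroupI)
  have sub: "subgroup H G" if "H \<in> \<C>" for H
    using ell[OF that] unfolding elliptic_subgroup_def by simp
  show "subgroup (\<Union>\<C>) G" using ne sub chain by (rule subgroup_Union_chain)
  fix x assume "x \<in> M"
  then have Mne: "M \<noteq> {}" by blast
  obtain \<epsilon> where \<epsilon>: "\<epsilon> > 0" and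
    centre: "\<And>H. elliptic_subgroup G M d \<phi> H \<Longrightarrow> \<exists>x\<in>M. \<forall>h\<in>H. d x (\<phi> h x) \<le> \<epsilon>"
    by (rule elliptic_subgroup_quasi_centre[OF hyp Mne]) (rule that; blast)
  obtain R and N :: nat where RN:
    "\<And>H x y. H \<subseteq> carrier G \<Longrightarrow> \<not> (finite H \<and> card H \<le> N) \<Longrightarrow> x \<in> M \<Longrightarrow> y \<in> M \<Longrightarrow>
       (\<And>h. h \<in> H \<Longrightarrow> d x (\<phi> h x) \<le> \<epsilon> \<and> d y (\<phi> h y) \<le> \<epsilon>) \<Longrightarrow> d x y \<le> R"
    by (rule large_subgroup_fixes_close_points[OF \<epsilon>]) (rule that; blast)
  show "\<exists>y\<in>M. \<exists>B. \<forall>h\<in>\<Union>\<C>. d y (\<phi> h y) \<le> B"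
  proof (cases "\<forall>H\<in>\<C>. finite H \<and> card H \<le> N")
    case True
    then have "\<Union>\<C> \<in> \<C>" using Union_chain_eq_member_of_card_le[OF ne _ chain] by blast
    then show ?thesis using ell centre by blast
  next
    case False
    then obtain K where K: "K \<in> \<C>" "\<not> (finite K \<and> card K \<le> N)" by blast
    obtain y where y: "y \<in> M" "\<And>h. h \<in> K \<Longrightarrow> d y (\<phi> h y) \<le> \<epsilon>" using centre[OF ell[OF K(1)]] by blast
    \<comment> \<open>The path from \<open>y\<close> to \<open>z\<close>, on to \<open>h z\<close>
      and then to \<open>h y\<close> has legs of length at most \<open>R\<close>,
      \<open>\<epsilon>\<close> and \<open>R\<close>, where \<open>z\<close> is a quasi-centre of a
      member \<open>L\<close> that contains both \<open>h\<close> and \<open>K\<close>.\<close>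
    have "d y (\<phi> h y) \<le> 2 * R + \<epsilon>" if h: "h \<in> \<Union>\<C>" for h
    proof -
      obtain L where L: "L \<in> \<C>" "h \<in> L" "K \<subseteq> L" using h K(1) chain by blast
      obtain z where z: "z \<in> M" "\<And>h. h \<in> L \<Longrightarrow> d z (\<phi> h z) \<le> \<epsilon>"
        using centre[OF ell[OF L(1)]] by blast
      have yz: "d y z \<le> R"
        using RN[OF subgroup.subset[OF sub[OF K(1)]] K(2) y(1) z(1)] y(2) z(2) L(3) by blast
      have hG: "h \<in> carrier G" using subgroup.mem_carrier[OF sub[OF L(1)] L(2)] .
      have hM: "\<phi> h y \<in> M" "\<phi> h z \<in> M" using action_closed[OF hG] y(1) z(1) by auto
      have "d (\<phi> h y) (\<phi> h z) = d y z" using isometric[OF hG y(1) z(1)] .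
      then show ?thesis
        using triangle[OF y(1) z(1) hM(1)] triangle[OF z(1) hM(2,1)] commute[of "\<phi> h y" "\<phi> h z"]
          z(2)[OF L(2)] yz by linarith
    qed
    then show ?thesis using y(1) by blast
  qed
qed

lemma ex_maximal_elliptic_subgroup:
  assumes "hyperbolic_space M d" "elliptic_subgroup G M d \<phi> H"
  shows "\<exists>K. maximal_elliptic_subgroup G M d \<phi> K \<and> H \<subseteq> K"
proof -
  let ?A = "{K. elliptic_subgroup G M d \<phi> K \<and> H \<subseteq> K}"
  have "\<Union>\<C> \<in> ?A" if "\<C> \<noteq> {}" "subset.chain ?A \<C>" for \<C>
  proof -
    have \<C>: "\<C> \<subseteq> ?A" "\<forall>X\<in>\<C>. \<forall>Y\<in>\<C>. X \<subseteq> Y \<or> Y \<subseteq> X"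
      using that(2) unfolding subset_chain_def by simp_all
    have "elliptic_subgroup G M d \<phi> X" if "X \<in> \<C>" for X using \<C>(1) that by auto
    then have "elliptic_subgroup G M d \<phi> (\<Union>\<C>)"
      using \<C>(2) by (intro elliptic_subgroup_Union_chain[OF assms(1) that(1)]) simp_all
    moreover have "H \<subseteq> \<Union>\<C>" using \<C>(1) that(1) by auto
    ultimately show ?thesis by simp
  qed
  then have "\<exists>K\<in>?A. \<forall>X\<in>?A. K \<subseteq> X \<longrightarrow> X = K"
    using assms(2) by (intro subset_Zorn_nonempty) auto
  then obtain K where K: "K \<in> ?A" "\<forall>X\<in>?A. K \<subseteq> X \<longrightarrow> X = K" by (elim bexE)
  \<comment> \<open>Anything above \<open>K\<close> contains \<open>H\<close> as well, so maximality
    in \<open>?A\<close> is maximality among all elliptic subgroups.\<close>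
  have "X = K" if "elliptic_subgroup G M d \<phi> X" "K \<subseteq> X" for X
    using K that subset_trans[of H K X] by simp
  then have "maximal_elliptic_subgroup G M d \<phi> K"
    unfolding maximal_elliptic_subgroup_def using K(1) by simp
  then show ?thesis using K(1) by (intro exI[of _ K]) simp
qed

end

section \<open>The commensurator\<close>

context group
begin

lemma mem_conjugate_iff:
  assumes "H \<subseteq> carrier G" "g \<in> carrier G"
  shows "a \<in> conjugate G H g \<longleftrightarrow> a \<in> carrier G \<and> g \<otimes> a \<otimes> inv g \<in> H"
proof -
  have eq: "conjugate G H g = (\<lambda>h. inv g \<otimes> h \<otimes> g) ` H"
    unfolding conjugate_def l_coset_def r_coset_def by auto
  show ?thesis
  proof
    assume "a \<in> conjugate G H g"
    then obtain h where h: "h \<in> H" "a = inv g \<otimes> h \<otimes> g" unfolding eq by (elim imageE)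
    have hG: "h \<in> carrier G" using assms(1) h(1) by (rule subsetD)
    have "g \<otimes> (inv g \<otimes> h) = h" using assms(2) hG by (simp add: m_assoc[symmetric])
    then have "g \<otimes> a \<otimes> inv g = h" using assms(2) hG h(2) by (simp add: m_assoc)
    then show "a \<in> carrier G \<and> g \<otimes> a \<otimes> inv g \<in> H" using h hG assms(2) by simp
  next
    assume a: "a \<in> carrier G \<and> g \<otimes> a \<otimes> inv g \<in> H"
    then have "inv g \<otimes> (g \<otimes> a) = a" using assms(2) by (simp add: m_assoc[symmetric])
    then have "a = inv g \<otimes> (g \<otimes> a \<otimes> inv g) \<otimes> g" using a assms(2) by (simp add: m_assoc)
    then show "a \<in> conjugate G H g" unfolding eq using a by (intro image_eqI) blast+
  qed
qed

lemma subgroup_conjugate: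
  assumes "subgroup H G" "g \<in> carrier G"
  shows "subgroup (conjugate G H g) G"
proof (rule subgroupI)
  note iff = mem_conjugate_iff[OF subgroup.subset[OF assms(1)] assms(2)]
  show "conjugate G H g \<subseteq> carrier G" using iff by blast
  have "\<one> \<in> conjugate G H g" using iff assms by (simp add: subgroup.one_closed)
  then show "conjugate G H g \<noteq> {}" by blast
  show "inv a \<in> conjugate G H g" if "a \<in> conjugate G H g" for a
  proof -
    have a: "a \<in> carrier G" "g \<otimes> a \<otimes> inv g \<in> H" using that iff by auto
    have "g \<otimes> inv a \<otimes> inv g = inv (g \<otimes> a \<otimes> inv g)"
      using a assms(2) by (simp add: inv_mult_group m_assoc)
    then show ?thesis using iff a assms(1) by (simp add: subgroup.m_inv_closed)
  qed
  show "a \<otimes> b \<in> conjugate G H g" if "a \<in> conjugate G H g" "b \<in> conjugate G H g" for a b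
  proof -
    have a: "a \<in> carrier G" "g \<otimes> a \<otimes> inv g \<in> H" using that iff by auto
    have b: "b \<in> carrier G" "g \<otimes> b \<otimes> inv g \<in> H" using that iff by auto
    have "inv g \<otimes> (g \<otimes> (b \<otimes> inv g)) = b \<otimes> inv g"
      using b assms(2) by (simp add: m_assoc[symmetric])
    then have "g \<otimes> (a \<otimes> b) \<otimes> inv g = (g \<otimes> a \<otimes> inv g) \<otimes> (g \<otimes> b \<otimes> inv g)"
      using a b assms(2) by (simp add: m_assoc)
    then show ?thesis using iff a b assms(1) by (simp add: subgroup.m_closed)
  qed
qed

text \<open>Sending \<open>a\<close> to \<open>K #> a\<close> embeds the right cosets of
  \<open>H \<inter> K\<close> in \<open>H\<close> into those of \<open>K\<close> in
  \<open>G\<close>. The index is thus finite exactly when \<open>H\<close> meets finitely many right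
  cosets of \<open>K\<close>, a condition free of the intersection and with representatives allowed
  anywhere in \<open>G\<close>.\<close>

lemma finite_index_Int_iff:
  assumes H: "subgroup H G" and K: "subgroup K G"
  shows "finite_index G H (H \<inter> K) \<longleftrightarrow> (\<exists>F. finite F \<and> F \<subseteq> carrier G \<and> H \<subseteq> K <#> F)"
proof -
  let ?L = "H \<inter> K"
  have L: "subgroup ?L G" using H K by (rule subgroups_Inter_pair)
  have cosets: "rcosets\<^bsub>G\<lparr>carrier := H\<rparr>\<^esub> ?L = (\<lambda>a. ?L #> a) ` H"
    unfolding RCOSETS_def r_coset_def by auto
  have HG: "H \<subseteq> carrier G" using H by (rule subgroup.subset)
  show ?thesis
  proof
    assume "finite_index G H ?L"
    then have "finite ((\<lambda>a. ?L #> a) ` H)" unfolding finite_index_def cosets .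
    then obtain F where F: "F \<subseteq> H" "finite F" "(\<lambda>a. ?L #> a) ` H = (\<lambda>a. ?L #> a) ` F"
      using finite_subset_image[of "(\<lambda>a. ?L #> a) ` H" "\<lambda>a. ?L #> a" H] by auto
    have "a \<in> K <#> F" if a: "a \<in> H" for a
    proof -
      obtain f where f: "f \<in> F" "?L #> a = ?L #> f" using F(3) a by blast
      have "a \<in> ?L #> a" using L a HG rcos_self by blast
      then show ?thesis using f unfolding r_coset_def set_mult_def by auto
    qed
    then have "H \<subseteq> K <#> F" by (rule subsetI)
    then show "\<exists>F. finite F \<and> F \<subseteq> carrier G \<and> H \<subseteq> K <#> F"
      using F(2) subset_trans[OF F(1) HG] by (intro exI conjI)
  next
    assume "\<exists>F. finite F \<and> F \<subseteq> carrier G \<and> H \<subseteq> K <#> F"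
    then obtain F where F: "finite F" "F \<subseteq> carrier G" "H \<subseteq> K <#> F" by blast
    have "\<exists>f\<in>F. a \<in> K #> f" if "a \<in> H" for a
      using that F(3) unfolding r_coset_def set_mult_def by blast
    then obtain t where t: "\<And>a. a \<in> H \<Longrightarrow> t a \<in> F \<and> a \<in> K #> t a" by metis
    \<comment> \<open>Equal labels put \<open>a\<close> and \<open>b\<close> in one right coset of
      \<open>K\<close>; the quotient of \<open>a\<close> by \<open>b\<close> then lies in
      \<open>K\<close>, and in \<open>H\<close> because both elements do.\<close>
    have eq: "?L #> a = ?L #> b" if ab: "a \<in> H" "b \<in> H" "t a = t b" for a b
    proof -
      have tG: "t b \<in> carrier G" using t[OF ab(2)] F(2) by blast
      have "K #> a = K #> t b" "K #> b = K #> t b"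
        using repr_independence[OF _ tG K] t[OF ab(1)] t[OF ab(2)] ab(3) by simp_all
      moreover have "a \<in> K #> a"
        using K ab(1) HG rcos_self by blast
      ultimately have "a \<in> K #> b" by simp
      then obtain k where k: "k \<in> K" "a = k \<otimes> b" unfolding r_coset_def by blast
      have "k = a \<otimes> inv b"
        using k ab HG subgroup.mem_carrier[OF K k(1)] by (simp add: inv_solve_right subset_iff)
      then have "k \<in> ?L" using k(1) H ab by (simp add: subgroup.m_closed subgroup.m_inv_closed)
      then have "a \<in> ?L #> b" using k(2) unfolding r_coset_def by blast
      then show ?thesis using repr_independence[OF _ _ L, of a b] ab(2) HG by blast
    qed
    \<comment> \<open>A coset is determined by its label in \<open>F\<close>. On labels that do not
      occur \<open>SOME\<close> is arbitrary, which is harmless for an inclusion.\<close>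
    have "(\<lambda>a. ?L #> a) ` H \<subseteq> (\<lambda>f. ?L #> (SOME a. a \<in> H \<and> t a = f)) ` F"
    proof (rule image_subsetI)
      fix a assume a: "a \<in> H"
      let ?b = "SOME b. b \<in> H \<and> t b = t a"
      have "?b \<in> H \<and> t ?b = t a" by (rule someI[of _ a]) (simp add: a)
      then have "?L #> a = ?L #> ?b" using eq[OF a] by simp
      then show "?L #> a \<in> (\<lambda>f. ?L #> (SOME a. a \<in> H \<and> t a = f)) ` F" using t[OF a] by blast
    qed
    then show "finite_index G H ?L"
      unfolding finite_index_def cosets using F(1) finite_subset by blast
  qed
qed

section \<open>The commensurator through coverings by cosets\<close>

lemma finite_set_mult: "finite A \<Longrightarrow> finite B \<Longrightarrow> finite (A <#> B)"
  unfolding set_mult_def by simp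

text \<open>For a subgroup \<open>H\<close> this says that the double coset \<open>HgH\<close> is a
  finite union of right cosets of \<open>H\<close>, the condition familiar from Hecke pairs.\<close>

definition coset_covered :: "'a set \<Rightarrow> 'a \<Rightarrow> bool" where
  "coset_covered H g \<longleftrightarrow> (\<exists>F. finite F \<and> F \<subseteq> carrier G \<and> g <# H \<subseteq> H <#> F)"

text \<open>The two coverings compose: \<open>ghH\<close> lies in \<open>gHF\<close>, and
  \<open>gHF\<close> lies in \<open>HEF\<close>.\<close>

lemma coset_covered_mult:
  assumes "H \<subseteq> carrier G" "g \<in> carrier G" "h \<in> carrier G" "coset_covered H g" "coset_covered H h"
  shows "coset_covered H (g \<otimes> h)"
proof -
  obtain E F where E: "finite E" "E \<subseteq> carrier G" "g <# H \<subseteq> H <#> E"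
    and F: "finite F" "F \<subseteq> carrier G" "h <# H \<subseteq> H <#> F"
    using assms(4,5) unfolding coset_covered_def by blast
  have "g \<otimes> h <# H = g <# (h <# H)" using assms(1-3) by (simp add: lcos_m_assoc)
  also have "\<dots> \<subseteq> g <# (H <#> F)" using F(3) unfolding l_coset_eq_set_mult by (simp add: mono_set_mult)
  also have "\<dots> = (g <# H) <#> F"
    using assms(1,2) F(2) by (simp add: l_coset_eq_set_mult set_mult_assoc)
  also have "\<dots> \<subseteq> (H <#> E) <#> F" using E(3) by (simp add: mono_set_mult)
  also have "\<dots> = H <#> (E <#> F)" using assms(1) E(2) F(2) by (rule set_mult_assoc)
  finally have "g \<otimes> h <# H \<subseteq> H <#> (E <#> F)" .
  moreover have "finite (E <#> F)" using E(1) F(1) by (rule finite_set_mult)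
  moreover have "E <#> F \<subseteq> carrier G" using E(2) F(2) by (rule set_mult_closed)
  ultimately show ?thesis unfolding coset_covered_def by (intro exI conjI)
qed

text \<open>Unlike the two index conditions, this description is visibly closed under products.\<close>

lemma mem_commensurator_iff:
  assumes H: "subgroup H G"
  shows "g \<in> commensurator G H \<longleftrightarrow>
    g \<in> carrier G \<and> coset_covered H g \<and> coset_covered H (inv g)"
proof (cases "g \<in> carrier G")
  case g: True
  let ?K = "conjugate G H g"
  have HG: "H \<subseteq> carrier G" using H by (rule subgroup.subset)
  have ig: "inv g \<in> carrier G" using g by simp
  have K: "subgroup ?K G" using subgroup_conjugate[OF H g] .
  \<comment> \<open>Left translation by \<open>x\<close> permutes the finite subsets of
    \<open>G\<close>, so the covering set may be renamed from \<open>F\<close> to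
    \<open>x <# F\<close>.\<close>
  have translate: "(\<exists>F. finite F \<and> F \<subseteq> carrier G \<and> P F) \<longleftrightarrow> (\<exists>F. finite F \<and> F \<subseteq> carrier G \<and> Q F)"
    if "x \<in> carrier G" "\<And>F. F \<subseteq> carrier G \<Longrightarrow> P (x <# F) \<longleftrightarrow> Q F" for P Q x
  proof
    assume "\<exists>F. finite F \<and> F \<subseteq> carrier G \<and> P F"
    then obtain F where F: "finite F" "F \<subseteq> carrier G" "P F" by blast
    have "x <# (inv x <# F) = F" using that(1) F(2) by (simp add: lcos_m_assoc lcos_mult_one)
    moreover have sub: "inv x <# F \<subseteq> carrier G" using l_coset_subset_G[OF F(2)] that(1) by simp
    ultimately have "Q (inv x <# F)" using that(2)[OF sub] F(3) by simp
    moreover have "finite (inv x <# F)" using F(1) unfolding l_coset_def by simp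
    ultimately show "\<exists>F. finite F \<and> F \<subseteq> carrier G \<and> Q F" using sub by (intro exI conjI)
  next
    assume "\<exists>F. finite F \<and> F \<subseteq> carrier G \<and> Q F"
    then obtain F where F: "finite F" "F \<subseteq> carrier G" "Q F" by blast
    then have "finite (x <# F)" "P (x <# F)" using that(2)[OF F(2)] unfolding l_coset_def by simp_all
    then show "\<exists>F. finite F \<and> F \<subseteq> carrier G \<and> P F"
      using l_coset_subset_G[OF F(2) that(1)] by (intro exI conjI)
  qed
  \<comment> \<open>As \<open>?K\<close> is \<open>g^-1 H g\<close>, the product on the left is
    \<open>g^-1 HF\<close>, and multiplying by \<open>g\<close> moves that factor to
    \<open>H\<close>.\<close>
  have "H \<subseteq> ?K <#> (inv g <# F) \<longleftrightarrow> g <# H \<subseteq> H <#> F" if F: "F \<subseteq> carrier G" for F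
  proof -
    have "?K <#> (inv g <# F) = inv g <# (H <#> F)"
    proof -
      have "?K <#> (inv g <# F) = (?K #> inv g) <#> F"
        using F ig subgroup.subset[OF K] by (simp add: rcos_assoc_lcos)
      also have "?K #> inv g = inv g <# H"
        unfolding conjugate_def using HG g l_coset_subset_G[OF HG ig]
        by (simp add: coset_mult_assoc coset_mult_one)
      also have "\<dots> <#> F = inv g <# (H <#> F)"
        using F ig HG by (simp add: l_coset_eq_set_mult set_mult_assoc)
      finally show ?thesis .
    qed
    moreover have "H \<subseteq> inv g <# X \<longleftrightarrow> g <# H \<subseteq> X" if X: "X \<subseteq> carrier G" for X
    proof
      assume "H \<subseteq> inv g <# X"
      then have "g <# H \<subseteq> g <# (inv g <# X)" unfolding l_coset_def by blast
      then show "g <# H \<subseteq> X" using X g by (simp add: lcos_m_assoc lcos_mult_one)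
    next
      assume "g <# H \<subseteq> X"
      then have "inv g <# (g <# H) \<subseteq> inv g <# X" unfolding l_coset_def by blast
      then show "H \<subseteq> inv g <# X" using HG g by (simp add: lcos_m_assoc lcos_mult_one)
    qed
    ultimately show ?thesis using set_mult_closed[OF HG F] by simp
  qed
  then have 1: "finite_index G H (H \<inter> ?K) \<longleftrightarrow> coset_covered H g"
    unfolding finite_index_Int_iff[OF H K] coset_covered_def
    by (intro translate[OF ig])
  have 2: "finite_index G ?K (H \<inter> ?K) \<longleftrightarrow> coset_covered H (inv g)"
  proof -
    have sub: "inv g <# H \<subseteq> carrier G" using l_coset_subset_G[OF HG ig] .
    have r_sub: "X #> a \<subseteq> H <#> (F #> a)"
      if "X \<subseteq> H <#> F" "X \<subseteq> carrier G" "F \<subseteq> carrier G" "a \<in> carrier G" for X F a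
    proof -
      have "X #> a \<subseteq> (H <#> F) #> a" using that(1) unfolding r_coset_def by blast
      then show ?thesis using setmult_rcos_assoc[OF HG that(3,4)] by simp
    qed
    have fin: "finite (F #> a)" if "finite F" for F a using that unfolding r_coset_def by simp
    \<comment> \<open>Here \<open>?K\<close> and \<open>g^-1 H\<close> differ only by a factor on
      the right, which is absorbed into the finite set \<open>F\<close>.\<close>
    have "(\<exists>F. finite F \<and> F \<subseteq> carrier G \<and> ?K \<subseteq> H <#> F) \<longleftrightarrow> coset_covered H (inv g)"
    proof
      assume "\<exists>F. finite F \<and> F \<subseteq> carrier G \<and> ?K \<subseteq> H <#> F"
      then obtain F where F: "finite F" "F \<subseteq> carrier G" "?K \<subseteq> H <#> F" by blast
      have "inv g <# H = ?K #> inv g"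
        unfolding conjugate_def using g sub by (simp add: coset_mult_assoc coset_mult_one)
      also have "\<dots> \<subseteq> H <#> (F #> inv g)" using r_sub[OF F(3) subgroup.subset[OF K] F(2) ig] .
      finally show "coset_covered H (inv g)"
        unfolding coset_covered_def using fin F(1) r_coset_subset_G[OF F(2) ig] by blast
    next
      assume "coset_covered H (inv g)"
      then obtain F where F: "finite F" "F \<subseteq> carrier G" "inv g <# H \<subseteq> H <#> F"
        unfolding coset_covered_def by blast
      then have "?K \<subseteq> H <#> (F #> g)" unfolding conjugate_def using r_sub sub g by blast
      then show "\<exists>F. finite F \<and> F \<subseteq> carrier G \<and> ?K \<subseteq> H <#> F"
        using fin F(1) r_coset_subset_G[OF F(2) g] by blast
    qed
    then show ?thesis using finite_index_Int_iff[OF K H] by (simp add: Int_commute)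
  qed
  show ?thesis using g 1 2 unfolding commensurator_def by simp
qed (simp add: commensurator_def)

lemma subgroup_subset_commensurator:
  assumes "subgroup H G"
  shows "H \<subseteq> commensurator G H"
proof
  fix h assume h: "h \<in> H"
  have "coset_covered H a" if a: "a \<in> H" for a
  proof -
    have "a <# H \<subseteq> H" unfolding l_coset_def using subgroup.m_closed[OF assms a] by auto
    also have "H = H <#> {\<one>}"
      unfolding r_coset_eq_set_mult[symmetric] using coset_mult_one[OF subgroup.subset[OF assms]] ..
    finally have "a <# H \<subseteq> H <#> {\<one>}" .
    then show ?thesis unfolding coset_covered_def by (intro exI[of _ "{\<one>}"]) simp
  qed
  then show "h \<in> commensurator G H"
    using h assms by (simp add: mem_commensurator_iff subgroup.mem_carrier subgroup.m_inv_closed)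
qed

lemma subgroup_commensurator:
  assumes H: "subgroup H G"
  shows "subgroup (commensurator G H) G"
proof (rule subgroupI)
  note iff = mem_commensurator_iff[OF H]
  show "commensurator G H \<subseteq> carrier G" using iff by blast
  show "commensurator G H \<noteq> {}"
    using subgroup_subset_commensurator[OF H] subgroup.one_closed[OF H] by blast
  show "inv a \<in> commensurator G H" if "a \<in> commensurator G H" for a using that iff by simp
  show "a \<otimes> b \<in> commensurator G H" if "a \<in> commensurator G H" "b \<in> commensurator G H" for a b
    using that iff coset_covered_mult[OF subgroup.subset[OF H]] by (simp add: inv_mult_group)
qed

lemma infinite_of_finite_index:
  assumes H: "subgroup H G" "infinite H" and K: "subgroup K G" and "finite_index G H (H \<inter> K)"
  shows "infinite (H \<inter> K)"
proof
  let ?L = "H \<inter> K"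
  assume fin: "finite ?L"
  have L: "subgroup ?L G" using H(1) K by (rule subgroups_Inter_pair)
  \<comment> \<open>This allows the covering criterion to be applied with \<open>?L\<close> in place
    of \<open>K\<close>: \<open>H\<close> is then covered by finitely many translates of a finite
    set.\<close>
  have "H \<inter> ?L = ?L" by blast
  then have "finite_index G H (H \<inter> ?L)" using assms(4) by simp
  then obtain F where "finite F" "H \<subseteq> ?L <#> F" using finite_index_Int_iff[OF H(1) L] by blast
  moreover from this(1) fin have "finite (?L <#> F)" by (intro finite_set_mult)
  ultimately show False using H(2) finite_subset[of H "?L <#> F"] by simp
qed

end

section \<open>Ellipticity of the commensurator\<close>

lemma (in acylindrical_action) elliptic_subgroup_commensurator:
  assumes "elliptic_subgroup G M d \<phi> H" "infinite H"
  shows "elliptic_subgroup G M d \<phi> (commensurator G H)"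
proof (rule elliptic_subgroupI)
  have H: "subgroup H G" using assms(1) unfolding elliptic_subgroup_def by simp
  have HG: "H \<subseteq> carrier G" using H by (rule subgroup.subset)
  show "subgroup (commensurator G H) G" using H by (rule subgroup_commensurator)
  fix x assume x: "x \<in> M"
  obtain B where "\<forall>h\<in>H. d x (\<phi> h x) \<le> B" using assms(1) elliptic_subgroup_iff[OF x] by blast
  \<comment> \<open>With \<open>H\<close> fixed, its own bound at \<open>x\<close> serves as
    \<open>\<epsilon>\<close>; the maximum with 1 provides the positivity that acylindricity asks
    for.\<close>
  then have \<epsilon>: "max B 1 > 0" "\<And>h. h \<in> H \<Longrightarrow> d x (\<phi> h x) \<le> max B 1"
    by (auto simp: le_max_iff_disj)
  obtain R and N :: nat where RN:
    "\<And>K x y. K \<subseteq> carrier G \<Longrightarrow> \<not> (finite K \<and> card K \<le> N) \<Longrightarrow> x \<in> M \<Longrightarrow> y \<in> M \<Longrightarrow>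
       (\<And>h. h \<in> K \<Longrightarrow> d x (\<phi> h x) \<le> max B 1 \<and> d y (\<phi> h y) \<le> max B 1) \<Longrightarrow> d x y \<le> R"
    by (rule large_subgroup_fixes_close_points[OF \<epsilon>(1)]) (rule that; blast)
  have "d x (\<phi> g x) \<le> R" if "g \<in> commensurator G H" for g
  proof -
    have g: "g \<in> carrier G" and fi: "finite_index G H (H \<inter> conjugate G H g)"
      using that unfolding commensurator_def by auto
    have K: "subgroup (conjugate G H g) G" using subgroup_conjugate[OF H g] .
    define y where "y = \<phi> (inv g) x"
    have yM: "y \<in> M" unfolding y_def using action_closed[of "inv g" x] g x by simp
    have gy: "\<phi> g y = x" unfolding y_def
      using g x composition_rule[of x g "inv g"] fun_cong[OF id_eq_one, of x] by simp
    \<comment> \<open>Applying \<open>g\<close> turns the displacement of \<open>y\<close> under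
      \<open>k\<close> into that of \<open>x\<close> under \<open>g k g^-1\<close>, an element of
      \<open>H\<close>.\<close>
    have "d y (\<phi> k y) \<le> max B 1" if "k \<in> conjugate G H g" for k
    proof -
      have k: "k \<in> carrier G" "g \<otimes> k \<otimes> inv g \<in> H" using that mem_conjugate_iff[OF HG g] by auto
      have "d y (\<phi> k y) = d (\<phi> g y) (\<phi> g (\<phi> k y))"
        using isometric[OF g yM] action_closed[OF k(1) yM] by simp
      also have "\<phi> g (\<phi> k y) = \<phi> (g \<otimes> k \<otimes> inv g) x"
        unfolding y_def using g k(1) x action_closed[of "inv g" x]
        by (simp add: composition_rule)
      finally show ?thesis using gy \<epsilon>(2)[OF k(2)] by simp
    qed
    then have "d x y \<le> R"
      using RN[of "H \<inter> conjugate G H g" x y] HG x yM \<epsilon>(2)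
        infinite_of_finite_index[OF H assms(2) K fi] by auto
    \<comment> \<open>The isometry \<open>g\<close> carries the pair \<open>x\<close>,
      \<open>y\<close> to \<open>g x\<close>, \<open>x\<close>, so the bound on \<open>d x y\<close>
      bounds the displacement of \<open>x\<close> under \<open>g\<close>.\<close>
    moreover have "d (\<phi> g x) x = d x y" using isometric[OF g x yM] gy by simp
    ultimately show ?thesis using commute[of x "\<phi> g x"] by simp
  qed
  then show "\<exists>y\<in>M. \<exists>B. \<forall>h\<in>commensurator G H. d y (\<phi> h y) \<le> B" using x by blast
qed

theorem corollary1p6:
  fixes G :: "('g, 'm) monoid_scheme"
    and M :: "'s set" and d :: "'s \<Rightarrow> 's \<Rightarrow> real"
    and \<phi> :: "'g \<Rightarrow> 's \<Rightarrow> 's"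
  assumes "hyperbolic_space M d"
    and "acylindrical_action G M d \<phi>"
  shows "(\<forall>H. elliptic_subgroup G M d \<phi> H \<longrightarrow>
            (\<exists>K. maximal_elliptic_subgroup G M d \<phi> K \<and> H \<subseteq> K)) \<and>
         (\<forall>H. maximal_elliptic_subgroup G M d \<phi> H \<and> infinite H \<longrightarrow>
            H = commensurator G H)"
proof -
  interpret acylindrical_action G M d \<phi> by fact
  have "H = commensurator G H" if "maximal_elliptic_subgroup G M d \<phi> H" "infinite H" for H
  proof -
    have H: "elliptic_subgroup G M d \<phi> H" "subgroup H G"
      using that(1) unfolding maximal_elliptic_subgroup_def elliptic_subgroup_def by auto
    have "commensurator G H = H"
      using that(1) elliptic_subgroup_commensurator[OF H(1) that(2)]
        subgroup_subset_commensurator[OF H(2)]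
      unfolding maximal_elliptic_subgroup_def by simp
    then show ?thesis ..
  qed
  then show ?thesis using ex_maximal_elliptic_subgroup[OF assms(1)] by simp
qed

end
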